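(* Let $O\subset\mathbb{R}^3$ be open and let $F$ be an upper semi-continuous set-valued map assigning to each point of $O$ a closed subset of $\Delta^2\times\mathbb{R}$, where $\Delta$ is the (boundary of the) reference triangle. Let $(X_n,d_n)$, $n\in\mathbb{N}$, and $(X,d)$ be bounded Lorentzian length spaces with $d_{GH}(X_n,X)\to 0$. If every $(X_n,d_n)$ has $(O,F)$-bounded sectional curvature, then so has $(X,d)$.
   Context: A bounded Lorentzian-metric space $(X,d)$ is a set $X$ with a map $d\colon X\times X\to[0,\infty)$ such that: (i) if $d(x,y)>0$ and $d(y,z)>0$ then $d(x,z)\ge d(x,y)+d(y,z)$; (ii) there is a topology $T$ on $X$ such that $d$ is continuous for $T\times T$ and for every $\epsilon>0$ the set $\{(p,q): d(p,q)\ge\epsilon\}$ is compact for $T\times T$; (iii) for every $x\ne y$ there is $z$ with $d(x,z)\ne d(y,z)$ or $d(z,x)\ne d(z,y)$. The topology $\mathscr{T}$ of $(X,d)$ is the intersection of all topologies $T$ as in (ii); topological notions on $X$ refer to $\mathscr{T}$. Write $x\ll y$ if $d(x,y)>0$. Write $x\le y$ if for all $p\in X$, $d(p,y)\ge d(p,x)$ and $d(x,p)\ge d(y,p)$; write $x<y$ if $x\le y$ and $x\neq y$. A continuous curve $\sigma\colon[a,b]\to X$ is isocausal if $\sigma(t)<\sigma(t')$ whenever $t<t'$; it is maximal if moreover $d(\sigma(t),\sigma(t'))+d(\sigma(t'),\sigma(t''))=d(\sigma(t),\sigma(t''))$ for all $t<t'<t''$. A bounded Lorentzian length space is a bounded Lorentzian-metric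 space in which any $x\ll y$ are connected by a maximal isocausal curve from $x$ to $y$. A correspondence between nonempty sets $X$ and $Y$ is a relation $R\subset X\times Y$ such that every $x\in X$ is related to some $y\in Y$ and vice versa; $\mathrm{dis}\,R=\sup\{|d_X(x,x')-d_Y(y,y')| : (x,y),(x',y')\in R\}$ and $d_{GH}(X,Y)=\inf_R \mathrm{dis}\,R$ over all correspondences. A timelike triangle in $(X,d)$ is a triple $(x,y,z)$ with $x\ll y\ll z$; set $a=d(x,y)$, $b=d(y,z)$, $c=d(x,z)$. A point $p\in X$ is on the side $xy$ with parameter $\alpha\in[0,1]$ if $d(x,p)+d(p,y)=d(x,y)$ and $d(x,p)=\alpha d(x,y)$; on the side $yz$ with parameter $\beta\in[0,1]$ if $d(y,p)+d(p,z)=d(y,z)$ and $d(y,p)=\beta d(y,z)$; on the side $xz$ with parameter $\gamma\in[0,1]$ if $d(x,p)+d(p,z)=d(x,z)$ and $d(x,p)=\gamma d(x,z)$. The perimeter is the set of points on some side. $\Delta$ denotes a fixed triangle (union of three closed segments) with vertices $A,B,C$ in a 2-dimensional affine space, with sides $AB$, $BC$, $AC$ parametrized affinely by $\alpha,\beta,\gamma\in[0,1]$ respectively (from the first-named vertex to the second). A point $p$ of the perimeter of a timelike triangle $(x,y,z)$ corresponds to a point of $\Delta$ if the latter lies on side $AB$ (resp. $BC$, $AC$) with some parameter value and $p$ is on side $xy$ (resp. $yz$, $xz$) with the same parameter value (for a vertex of $\Delta$, which lies on two sides, correspondence along one of them is enough). A set-valued map $F$ on $O$ is upper semi-continuous if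 for every $u\in O$ and every open neighborhood $U\supset F(u)$ there is a neighborhood $N\ni u$ with $\bigcup_{v\in N}F(v)\subset U$. $(X,d)$ has $(O,F)$-bounded sectional curvature if for every timelike triangle in $X$ with $(a,b,c)\in O$ and every pair $(\delta_1,\delta_2)\in\Delta^2$ there are points $p,q$ in the perimeter of the timelike triangle corresponding to $\delta_1,\delta_2$ respectively such that $(\delta_1,\delta_2,d(p,q))\in F(a,b,c)$. *)

theory Defs
  imports "HOL-Analysis.Analysis"
begin

text \<open>Spaces are carrier-based: a set \<open>X\<close> together with a function \<open>d\<close> on the ambient type, whose
  values outside \<open>X \<times> X\<close> are irrelevant.\<close>

definition lm_admissible :: "'a set \<Rightarrow> ('a \<Rightarrow> 'a \<Rightarrow> real) \<Rightarrow> 'a topology \<Rightarrow> bool" where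
  "lm_admissible X d T \<longleftrightarrow>
     topspace T = X \<and>
     continuous_map (prod_topology T T) euclideanreal (\<lambda>(p, q). d p q) \<and>
     (\<forall>\<epsilon>>0. compactin (prod_topology T T) {(p, q) \<in> X \<times> X. d p q \<ge> \<epsilon>})"

definition bounded_lm_space :: "'a set \<Rightarrow> ('a \<Rightarrow> 'a \<Rightarrow> real) \<Rightarrow> bool" where
  "bounded_lm_space X d \<longleftrightarrow>
     (\<forall>x\<in>X. \<forall>y\<in>X. d x y \<ge> 0) \<and>
     (\<forall>x\<in>X. \<forall>y\<in>X. \<forall>z\<in>X. d x y > 0 \<and> d y z > 0 \<longrightarrow> d x z \<ge> d x y + d y z) \<and>
     (\<exists>T. lm_admissible X d T) \<and>
     (\<forall>x\<in>X. \<forall>y\<in>X. x \<noteq> y \<longrightarrow> (\<exists>z\<in>X. d x z \<noteq> d y z \<or> d z x \<noteq> d z y))"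

definition lm_topology :: "'a set \<Rightarrow> ('a \<Rightarrow> 'a \<Rightarrow> real) \<Rightarrow> 'a topology" where
  "lm_topology X d = topology (\<lambda>U. U \<subseteq> X \<and> (\<forall>T. lm_admissible X d T \<longrightarrow> openin T U))"

lemma openin_lm_topology:
  "openin (lm_topology X d) U \<longleftrightarrow> U \<subseteq> X \<and> (\<forall>T. lm_admissible X d T \<longrightarrow> openin T U)"
proof -
  have "istopology (\<lambda>U. U \<subseteq> X \<and> (\<forall>T. lm_admissible X d T \<longrightarrow> openin T U))"
    unfolding istopology_def by auto
  then show ?thesis
    by (simp add: lm_topology_def)
qed

lemma topspace_lm_topology [simp]: "topspace (lm_topology X d) = X"
proof -
  have "openin (lm_topology X d) X"
    unfolding openin_lm_topology by (auto simp: lm_admissible_def)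
  moreover have "topspace (lm_topology X d) \<subseteq> X"
    using openin_topspace openin_lm_topology by metis
  ultimately show ?thesis
    by (simp add: openin_subset subset_antisym)
qed

definition lm_causal :: "'a set \<Rightarrow> ('a \<Rightarrow> 'a \<Rightarrow> real) \<Rightarrow> 'a \<Rightarrow> 'a \<Rightarrow> bool" where
  "lm_causal X d x y \<longleftrightarrow> (\<forall>p\<in>X. d p y \<ge> d p x \<and> d x p \<ge> d y p)"

definition isocausal_curve ::
  "'a set \<Rightarrow> ('a \<Rightarrow> 'a \<Rightarrow> real) \<Rightarrow> real \<Rightarrow> real \<Rightarrow> (real \<Rightarrow> 'a) \<Rightarrow> bool" where
  "isocausal_curve X d a b \<sigma> \<longleftrightarrow>
     a \<le> b \<and>
     continuous_map (top_of_set {a..b}) (lm_topology X d) \<sigma> \<and>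
     (\<forall>t\<in>{a..b}. \<forall>t'\<in>{a..b}. t < t' \<longrightarrow> lm_causal X d (\<sigma> t) (\<sigma> t') \<and> \<sigma> t \<noteq> \<sigma> t')"

definition maximal_isocausal_curve ::
  "'a set \<Rightarrow> ('a \<Rightarrow> 'a \<Rightarrow> real) \<Rightarrow> real \<Rightarrow> real \<Rightarrow> (real \<Rightarrow> 'a) \<Rightarrow> bool" where
  "maximal_isocausal_curve X d a b \<sigma> \<longleftrightarrow>
     isocausal_curve X d a b \<sigma> \<and>
     (\<forall>t\<in>{a..b}. \<forall>t'\<in>{a..b}. \<forall>t''\<in>{a..b}. t < t' \<and> t' < t'' \<longrightarrow>
        d (\<sigma> t) (\<sigma> t') + d (\<sigma> t') (\<sigma> t'') = d (\<sigma> t) (\<sigma> t''))"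

definition bounded_lorentzian_length_space :: "'a set \<Rightarrow> ('a \<Rightarrow> 'a \<Rightarrow> real) \<Rightarrow> bool" where
  "bounded_lorentzian_length_space X d \<longleftrightarrow>
     bounded_lm_space X d \<and>
     (\<forall>x\<in>X. \<forall>y\<in>X. d x y > 0 \<longrightarrow>
        (\<exists>a b \<sigma>. maximal_isocausal_curve X d a b \<sigma> \<and> \<sigma> a = x \<and> \<sigma> b = y))"

definition correspondence :: "'a set \<Rightarrow> 'b set \<Rightarrow> ('a \<times> 'b) set \<Rightarrow> bool" where
  "correspondence X Y R \<longleftrightarrow>
     R \<subseteq> X \<times> Y \<and> (\<forall>x\<in>X. \<exists>y\<in>Y. (x, y) \<in> R) \<and> (\<forall>y\<in>Y. \<exists>x\<in>X. (x, y) \<in> R)"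

definition distortion ::
  "('a \<Rightarrow> 'a \<Rightarrow> real) \<Rightarrow> ('b \<Rightarrow> 'b \<Rightarrow> real) \<Rightarrow> ('a \<times> 'b) set \<Rightarrow> ennreal" where
  "distortion d e R = (SUP ((x, y), (x', y')) \<in> R \<times> R. ennreal \<bar>d x x' - e y y'\<bar>)"

text \<open>Values in \<^typ>\<open>ennreal\<close> make supremum and infimum genuine in all cases; in particular the
  distance between an empty and a nonempty space is \<open>\<infinity>\<close>.\<close>

definition gh_dist ::
  "'a set \<Rightarrow> ('a \<Rightarrow> 'a \<Rightarrow> real) \<Rightarrow> 'b set \<Rightarrow> ('b \<Rightarrow> 'b \<Rightarrow> real) \<Rightarrow> ennreal" where
  "gh_dist X d Y e = (INF R \<in> {R. correspondence X Y R}. distortion d e R)"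

definition timelike_triangle ::
  "'a set \<Rightarrow> ('a \<Rightarrow> 'a \<Rightarrow> real) \<Rightarrow> 'a \<Rightarrow> 'a \<Rightarrow> 'a \<Rightarrow> bool" where
  "timelike_triangle X d x y z \<longleftrightarrow> x \<in> X \<and> y \<in> X \<and> z \<in> X \<and> d x y > 0 \<and> d y z > 0"

definition on_side ::
  "'a set \<Rightarrow> ('a \<Rightarrow> 'a \<Rightarrow> real) \<Rightarrow> 'a \<Rightarrow> 'a \<Rightarrow> real \<Rightarrow> 'a \<Rightarrow> bool" where
  "on_side X d x y \<alpha> p \<longleftrightarrow>
     p \<in> X \<and> \<alpha> \<in> {0..1} \<and> d x p + d p y = d x y \<and> d x p = \<alpha> * d x y"

definition perimeter ::
  "'a set \<Rightarrow> ('a \<Rightarrow> 'a \<Rightarrow> real) \<Rightarrow> 'a \<Rightarrow> 'a \<Rightarrow> 'a \<Rightarrow> 'a set" where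
  "perimeter X d x y z =
     {p. \<exists>t. on_side X d x y t p \<or> on_side X d y z t p \<or> on_side X d x z t p}"

text \<open>The affine plane containing the reference triangle is \<^typ>\<open>real^2\<close>.\<close>

definition reference_triangle :: "real^2 \<Rightarrow> real^2 \<Rightarrow> real^2 \<Rightarrow> (real^2) set" where
  "reference_triangle A B C = closed_segment A B \<union> closed_segment B C \<union> closed_segment A C"

definition side_point :: "real^2 \<Rightarrow> real^2 \<Rightarrow> real \<Rightarrow> real^2" where
  "side_point P Q t = (1 - t) *\<^sub>R P + t *\<^sub>R Q"

definition corresponds ::
  "real^2 \<Rightarrow> real^2 \<Rightarrow> real^2 \<Rightarrow> 'a set \<Rightarrow> ('a \<Rightarrow> 'a \<Rightarrow> real) \<Rightarrow> 'a \<Rightarrow> 'a \<Rightarrow> 'a \<Rightarrow>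
   'a \<Rightarrow> real^2 \<Rightarrow> bool" where
  "corresponds A B C X d x y z p \<delta> \<longleftrightarrow>
     (\<exists>t\<in>{0..1}. (\<delta> = side_point A B t \<and> on_side X d x y t p) \<or>
                 (\<delta> = side_point B C t \<and> on_side X d y z t p) \<or>
                 (\<delta> = side_point A C t \<and> on_side X d x z t p))"

definition upper_semicontinuous_map ::
  "'a topology \<Rightarrow> 'b topology \<Rightarrow> ('a \<Rightarrow> 'b set) \<Rightarrow> bool" where
  "upper_semicontinuous_map S T F \<longleftrightarrow>
     (\<forall>u\<in>topspace S. \<forall>U. openin T U \<and> F u \<subseteq> U \<longrightarrow>
        (\<exists>N. openin S N \<and> u \<in> N \<and> (\<Union>v\<in>N. F v) \<subseteq> U))"

definition bounded_sectional_curvature ::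
  "real^2 \<Rightarrow> real^2 \<Rightarrow> real^2 \<Rightarrow> (real \<times> real \<times> real) set \<Rightarrow>
   (real \<times> real \<times> real \<Rightarrow> ((real^2) \<times> (real^2) \<times> real) set) \<Rightarrow>
   'a set \<Rightarrow> ('a \<Rightarrow> 'a \<Rightarrow> real) \<Rightarrow> bool" where
  "bounded_sectional_curvature A B C \<Omega> F X d \<longleftrightarrow>
     (\<forall>x y z. timelike_triangle X d x y z \<and> (d x y, d y z, d x z) \<in> \<Omega> \<longrightarrow>
        (\<forall>\<delta>\<^sub>1\<in>reference_triangle A B C. \<forall>\<delta>\<^sub>2\<in>reference_triangle A B C.
           \<exists>p\<in>perimeter X d x y z. \<exists>q\<in>perimeter X d x y z.
             corresponds A B C X d x y z p \<delta>\<^sub>1 \<and> corresponds A B C X d x y z q \<delta>\<^sub>2 \<and>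
             (\<delta>\<^sub>1, \<delta>\<^sub>2, d p q) \<in> F (d x y, d y z, d x z)))"

end

theory Submission
  imports Defs
begin

text \<open>
  Whether a point \<open>p\<close> corresponds to a point \<open>\<delta>\<close> of the reference triangle is a closed condition on
  finitely many real numbers: the three sides of the timelike triangle and the four distances
  \<open>d x p\<close>, \<open>d p y\<close>, \<open>d y p\<close>, \<open>d p z\<close>. The curvature bound therefore only speaks about such numbers
  and about \<open>d p q\<close>, and all of them survive, up to a small error, the passage through a
  correspondence of small distortion.

  Given a timelike triangle in \<open>X\<close>, a correspondence with a close \<open>X\<^sub>n\<close> yields a timelike triangle
  there with almost the same sides, which still lie in the open set \<open>\<Omega>\<close>. The curvature bound of
  \<open>X\<^sub>n\<close> gives comparison points, and carrying them back produces points \<open>p\<^sub>n, q\<^sub>n\<close> of \<open>X\<close> that satisfy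
  the required conditions approximately (\<open>approximate_comparison_pair\<close>).

  The space \<open>X\<close> itself need not be compact, but the points \<open>p\<^sub>n, q\<^sub>n\<close> stay in a compact part of it: a
  point on a side of length \<open>l\<close> has distance at least \<open>l/2\<close> from or to one of the end points, so that
  together with this vertex it forms a pair in one of the compact sets \<open>{d \<ge> \<epsilon>}\<close>. Consequently the
  numbers attached to \<open>(p\<^sub>n, q\<^sub>n)\<close> lie in the continuous image of a compact set
  (\<open>compact_pair_profiles\<close>). That image is a compact subset of a Euclidean space, so a subsequence
  converges to the numbers of an actual pair \<open>(p, q)\<close>; the sequence whose limit is taken consists of
  numbers, not of points of \<open>X\<close>.

  In the limit, \<open>p\<close> and \<open>q\<close> correspond to the given points because correspondence is a closed
  condition (\<open>corresponding_profiles_limit\<close>), and the triple formed with \<open>d p q\<close> belongs to the value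
  of \<open>F\<close> because an upper semi-continuous map with closed values has a closed graph
  (\<open>upper_semicontinuous_map_limit\<close>).
\<close>

section \<open>Numerical description of correspondence\<close>

definition triangle_sides :: "('a \<Rightarrow> 'a \<Rightarrow> real) \<Rightarrow> 'a \<Rightarrow> 'a \<Rightarrow> 'a \<Rightarrow> real \<times> real \<times> real" where
  "triangle_sides d x y z = (d x y, d y z, d x z)"

definition vertex_dists ::
  "('a \<Rightarrow> 'a \<Rightarrow> real) \<Rightarrow> 'a \<Rightarrow> 'a \<Rightarrow> 'a \<Rightarrow> 'a \<Rightarrow> real \<times> real \<times> real \<times> real" where
  "vertex_dists d x y z p = (d x p, d p y, d y p, d p z)"

text \<open>The parameter on a side of positive length is not quantified but expressed as a quotient of
  distances. For triangles with positive sides this makes the condition a union of three closed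
  ones, so that limits can be taken without tracking on which side, and at which
  parameter, the points of a sequence are located.\<close>

definition corresponding_profiles ::
  "real^2 \<Rightarrow> real^2 \<Rightarrow> real^2 \<Rightarrow> real^2 \<Rightarrow>
   ((real \<times> real \<times> real) \<times> (real \<times> real \<times> real \<times> real)) set" where
  "corresponding_profiles A B C \<delta> =
     {((a, b, c), (xp, py, yp, pz)).
        (xp + py = a \<and> xp / a \<in> {0..1} \<and> \<delta> = side_point A B (xp / a)) \<or>
        (yp + pz = b \<and> yp / b \<in> {0..1} \<and> \<delta> = side_point B C (yp / b)) \<or>
        (xp + pz = c \<and> xp / c \<in> {0..1} \<and> \<delta> = side_point A C (xp / c))}"

lemma on_side_iff_ratio:
  assumes "d x y > 0"
  shows "on_side X d x y t p \<longleftrightarrow>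
    p \<in> X \<and> d x p + d p y = d x y \<and> d x p / d x y \<in> {0..1} \<and> t = d x p / d x y"
proof -
  have "d x p = t * d x y \<longleftrightarrow> t = d x p / d x y"
    using assms by (auto simp: field_simps)
  then show ?thesis
    unfolding on_side_def by auto
qed

lemma corresponds_iff_profile:
  assumes "d x y > 0" "d y z > 0" "d x z > 0"
  shows "corresponds A B C X d x y z p \<delta> \<longleftrightarrow>
    p \<in> X \<and> (triangle_sides d x y z, vertex_dists d x y z p) \<in> corresponding_profiles A B C \<delta>"
  unfolding corresponds_def corresponding_profiles_def triangle_sides_def vertex_dists_def
    on_side_iff_ratio[of d, OF assms(1)] on_side_iff_ratio[of d, OF assms(2)]
    on_side_iff_ratio[of d, OF assms(3)]
  by auto

lemma corresponds_imp_perimeter: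
  "corresponds A B C X d x y z p \<delta> \<Longrightarrow> p \<in> perimeter X d x y z"
  unfolding corresponds_def perimeter_def by blast

text \<open>The map \<open>\<Phi>\<close> below sends the data to the defects in the three side equations together with the
  three side parameters. It is continuous where the sides do not vanish, and the profiles are the
  preimage under \<open>\<Phi>\<close> of a closed set \<open>S\<close>.\<close>

lemma corresponding_profiles_limit:
  assumes mem: "\<And>k. (u k, v k) \<in> corresponding_profiles A B C \<delta>"
    and u: "u \<longlonglongrightarrow> (a, b, c)" and v: "v \<longlonglongrightarrow> (xp, py, yp, pz)"
    and pos: "a > 0" "b > 0" "c > 0"
  shows "((a, b, c), (xp, py, yp, pz)) \<in> corresponding_profiles A B C \<delta>"
proof -
  define S :: "((real \<times> real) \<times> (real \<times> real) \<times> (real \<times> real)) set" where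
    "S = {w. (fst (fst w) = 0 \<and> 0 \<le> snd (fst w) \<and> snd (fst w) \<le> 1
               \<and> \<delta> = side_point A B (snd (fst w))) \<or>
             (fst (fst (snd w)) = 0 \<and> 0 \<le> snd (fst (snd w)) \<and> snd (fst (snd w)) \<le> 1
               \<and> \<delta> = side_point B C (snd (fst (snd w)))) \<or>
             (fst (snd (snd w)) = 0 \<and> 0 \<le> snd (snd (snd w)) \<and> snd (snd (snd w)) \<le> 1
               \<and> \<delta> = side_point A C (snd (snd (snd w))))}"
  define \<Phi> where "\<Phi> = (\<lambda>((a, b, c), (xp, py, yp, pz)).
     ((xp + py - a, xp / a), (yp + pz - b, yp / b), (xp + pz - c, xp / c :: real)))"
  have profile: "w \<in> corresponding_profiles A B C \<delta> \<longleftrightarrow> \<Phi> w \<in> S" for w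
    unfolding S_def \<Phi>_def corresponding_profiles_def by (cases w) auto
  have "closed S"
    unfolding S_def side_point_def
    by (intro closed_Collect_disj closed_Collect_conj closed_Collect_eq closed_Collect_le
        continuous_intros)
  moreover have "\<Phi> (u k, v k) \<in> S" for k
    using mem profile by blast
  moreover have "(\<lambda>k. \<Phi> (u k, v k)) \<longlonglongrightarrow> \<Phi> ((a, b, c), (xp, py, yp, pz))"
  proof -
    have 1: "(\<lambda>k. fst (u k)) \<longlonglongrightarrow> a" "(\<lambda>k. fst (snd (u k))) \<longlonglongrightarrow> b"
      "(\<lambda>k. snd (snd (u k))) \<longlonglongrightarrow> c"
      using tendsto_fst[OF u] tendsto_fst[OF tendsto_snd[OF u]] tendsto_snd[OF tendsto_snd[OF u]]
      by simp_all
    have 2: "(\<lambda>k. fst (v k)) \<longlonglongrightarrow> xp" "(\<lambda>k. fst (snd (v k))) \<longlonglongrightarrow> py"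
      "(\<lambda>k. fst (snd (snd (v k)))) \<longlonglongrightarrow> yp" "(\<lambda>k. snd (snd (snd (v k)))) \<longlonglongrightarrow> pz"
      using tendsto_fst[OF v] tendsto_fst[OF tendsto_snd[OF v]]
        tendsto_fst[OF tendsto_snd[OF tendsto_snd[OF v]]]
        tendsto_snd[OF tendsto_snd[OF tendsto_snd[OF v]]]
      by simp_all
    show ?thesis
      unfolding \<Phi>_def case_prod_beta fst_conv snd_conv
      using pos by (intro tendsto_intros 1 2) auto
  qed
  ultimately have "\<Phi> ((a, b, c), (xp, py, yp, pz)) \<in> S"
    by (rule closed_sequentially[where f = "\<lambda>k. \<Phi> (u k, v k)"])
  then show ?thesis
    using profile by blast
qed

section \<open>Transfer along correspondences of small distortion\<close>

lemma gh_dist_less_correspondence: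
  assumes "gh_dist X d Y e < ennreal \<epsilon>"
  obtains R where "correspondence X Y R"
    and "\<And>x y x' y'. (x, y) \<in> R \<Longrightarrow> (x', y') \<in> R \<Longrightarrow> \<bar>d x x' - e y y'\<bar> < \<epsilon>"
proof -
  obtain R where R: "correspondence X Y R" "distortion d e R < ennreal \<epsilon>"
    using assms unfolding gh_dist_def by (auto simp: INF_less_iff)
  have "\<bar>d x x' - e y y'\<bar> < \<epsilon>" if "(x, y) \<in> R" "(x', y') \<in> R" for x y x' y'
  proof -
    have "ennreal \<bar>d x x' - e y y'\<bar> \<le> distortion d e R"
      unfolding distortion_def using that by (intro SUP_upper2[of "((x, y), (x', y'))"]) auto
    with R(2) have "ennreal \<bar>d x x' - e y y'\<bar> < ennreal \<epsilon>"
      by (rule le_less_trans[rotated])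
    then show ?thesis
      by (simp add: ennreal_less_iff)
  qed
  with R(1) that show thesis
    by blast
qed

lemma dist_Pair_le: "dist (a, b) (c, e) \<le> dist a c + dist b e"
  unfolding dist_Pair_Pair by (rule sqrt_sum_squares_le_sum) auto

lemma dist_triangle_sides_le:
  assumes "\<bar>d x y - e x' y'\<bar> \<le> \<epsilon>" "\<bar>d y z - e y' z'\<bar> \<le> \<epsilon>" "\<bar>d x z - e x' z'\<bar> \<le> \<epsilon>"
  shows "dist (triangle_sides d x y z) (triangle_sides e x' y' z') \<le> 3 * \<epsilon>"
  using assms dist_Pair_le[of "d x y" "(d y z, d x z)" "e x' y'" "(e y' z', e x' z')"]
    dist_Pair_le[of "d y z" "d x z" "e y' z'" "e x' z'"]
  unfolding triangle_sides_def by (simp add: dist_real_def)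

lemma dist_vertex_dists_le:
  assumes "\<bar>d x p - e x' p'\<bar> \<le> \<epsilon>" "\<bar>d p y - e p' y'\<bar> \<le> \<epsilon>"
    "\<bar>d y p - e y' p'\<bar> \<le> \<epsilon>" "\<bar>d p z - e p' z'\<bar> \<le> \<epsilon>"
  shows "dist (vertex_dists d x y z p) (vertex_dists e x' y' z' p') \<le> 4 * \<epsilon>"
  using assms
    dist_Pair_le[of "d x p" "(d p y, d y p, d p z)" "e x' p'" "(e p' y', e y' p', e p' z')"]
    dist_Pair_le[of "d p y" "(d y p, d p z)" "e p' y'" "(e y' p', e p' z')"]
    dist_Pair_le[of "d y p" "d p z" "e y' p'" "e p' z'"]
  unfolding vertex_dists_def by (simp add: dist_real_def)

text \<open>The closed condition holds exactly for the data \<open>u, v, w, s\<close>, which are those of a triangle and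
  two comparison points in the approximating space \<open>Y\<close>; the points \<open>p, q\<close> of \<open>X\<close> only realize
  these data approximately. Keeping the two apart lets the limit be taken in the exact condition.\<close>

lemma approximate_comparison_pair:
  assumes X: "bounded_lm_space X d" and Y: "bounded_lm_space Y e"
    and gh: "gh_dist Y e X d < ennreal \<epsilon>"
    and curv: "bounded_sectional_curvature A B C \<Omega> F Y e"
    and \<delta>: "\<delta>\<^sub>1 \<in> reference_triangle A B C" "\<delta>\<^sub>2 \<in> reference_triangle A B C"
    and tri: "timelike_triangle X d x y z"
    and ball: "\<And>u. dist u (triangle_sides d x y z) \<le> 3 * \<epsilon> \<Longrightarrow> u \<in> \<Omega>"
    and small: "\<epsilon> < d x y" "\<epsilon> < d y z" 
  obtains p q u v w s where "p \<in> X" "q \<in> X" "u \<in> \<Omega>"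
    "dist u (triangle_sides d x y z) \<le> 3 * \<epsilon>"
    "(u, v) \<in> corresponding_profiles A B C \<delta>\<^sub>1" "dist v (vertex_dists d x y z p) \<le> 4 * \<epsilon>"
    "(u, w) \<in> corresponding_profiles A B C \<delta>\<^sub>2" "dist w (vertex_dists d x y z q) \<le> 4 * \<epsilon>"
    "(\<delta>\<^sub>1, \<delta>\<^sub>2, s) \<in> F u" "dist s (d p q) \<le> \<epsilon>"
proof -
  obtain R where R: "correspondence Y X R"
    and close: "\<And>y x y' x'. (y, x) \<in> R \<Longrightarrow> (y', x') \<in> R \<Longrightarrow> \<bar>e y y' - d x x'\<bar> < \<epsilon>"
    using gh_dist_less_correspondence[OF gh] by blast
  obtain x' y' z' where R3: "(x', x) \<in> R" "(y', y) \<in> R" "(z', z) \<in> R"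
    using R tri unfolding correspondence_def timelike_triangle_def by blast
  then have Y3: "x' \<in> Y" "y' \<in> Y" "z' \<in> Y"
    using R unfolding correspondence_def by auto
  have pos: "e x' y' > 0" "e y' z' > 0"
    using close[OF R3(1,2)] close[OF R3(2,3)] small by linarith+
  then have "e x' z' > 0"
    using Y Y3 unfolding bounded_lm_space_def by fastforce
  note pos = pos this
  define u where "u = triangle_sides e x' y' z'"
  have u: "dist u (triangle_sides d x y z) \<le> 3 * \<epsilon>"
    unfolding u_def using close[OF R3(1,2)] close[OF R3(2,3)] close[OF R3(1,3)]
    by (intro dist_triangle_sides_le) auto
  then have "u \<in> \<Omega>"
    by (rule ball)
  moreover have "timelike_triangle Y e x' y' z'"
    using Y3 pos unfolding timelike_triangle_def by blast
  ultimately obtain p' q' where "corresponds A B C Y e x' y' z' p' \<delta>\<^sub>1"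
    "corresponds A B C Y e x' y' z' q' \<delta>\<^sub>2" and F: "(\<delta>\<^sub>1, \<delta>\<^sub>2, e p' q') \<in> F u"
    using curv \<delta> unfolding bounded_sectional_curvature_def u_def triangle_sides_def by blast
  then have p': "p' \<in> Y" "(u, vertex_dists e x' y' z' p') \<in> corresponding_profiles A B C \<delta>\<^sub>1"
    and q': "q' \<in> Y" "(u, vertex_dists e x' y' z' q') \<in> corresponding_profiles A B C \<delta>\<^sub>2"
    using corresponds_iff_profile[of e, OF pos] unfolding u_def by blast+
  then obtain p q where pq: "p \<in> X" "q \<in> X" "(p', p) \<in> R" "(q', q) \<in> R"
    using R unfolding correspondence_def by blast
  have *: "dist (vertex_dists e x' y' z' r') (vertex_dists d x y z r) \<le> 4 * \<epsilon>"
    if "(r', r) \<in> R" for r r'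
    using close R3 that by (intro dist_vertex_dists_le less_imp_le) auto
  show thesis
  proof (rule that[OF pq(1,2) \<open>u \<in> \<Omega>\<close> u p'(2) *[OF pq(3)] q'(2) *[OF pq(4)] F])
    show "dist (e p' q') (d p q) \<le> \<epsilon>"
      using close[OF pq(3,4)] by (simp add: dist_real_def)
  qed
qed

section \<open>Compactness\<close>

text \<open>On whichever side the point lies, its two distances to the end points add up to a number that
  is at least \<open>2 * m\<close>.\<close>

lemma corresponding_profiles_large_dist:
  assumes "((a, b, c), (xp, py, yp, pz)) \<in> corresponding_profiles A B C \<delta>"
    and "2 * m \<le> a" "2 * m \<le> b" "2 * m \<le> c"
  shows "m \<le> xp \<or> m \<le> py \<or> m \<le> yp \<or> m \<le> pz"
  using assms unfolding corresponding_profiles_def by auto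

text \<open>The union of the two projections of \<open>{d \<ge> m}\<close> to \<open>X\<close>, a compact stand-in for the perimeters of
  all triangles that are close to a fixed one.\<close>

definition points_with_far_partner :: "'a set \<Rightarrow> ('a \<Rightarrow> 'a \<Rightarrow> real) \<Rightarrow> real \<Rightarrow> 'a set" where
  "points_with_far_partner X d m = {p\<in>X. \<exists>q\<in>X. d p q \<ge> m \<or> d q p \<ge> m}"

lemma compactin_points_with_far_partner:
  assumes "lm_admissible X d T" "m > 0"
  shows "compactin T (points_with_far_partner X d m)"
proof -
  let ?S = "{(p, q) \<in> X \<times> X. d p q \<ge> m}"
  have "compactin (prod_topology T T) ?S"
    using assms unfolding lm_admissible_def by blast
  then have "compactin T (fst ` ?S)" "compactin T (snd ` ?S)"
    by (auto intro!: image_compactin continuous_map_fst continuous_map_snd)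
  moreover have "points_with_far_partner X d m = fst ` ?S \<union> snd ` ?S"
    unfolding points_with_far_partner_def by force
  ultimately show ?thesis
    by (simp add: compactin_Un)
qed

text \<open>An error of at most \<open>m\<close> in the sides leaves sides of length at least \<open>4 * m\<close>, hence some distance
  of at least \<open>2 * m\<close> in the profile \<open>v\<close>; another error of \<open>m\<close> leaves \<open>m\<close> for the point \<open>p\<close> itself.
  This is where the factor \<open>5\<close> comes from.\<close>

lemma nearby_profile_has_far_partner:
  assumes "bounded_lm_space X d" "timelike_triangle X d x y z" "p \<in> X"
    and uv: "(u, v) \<in> corresponding_profiles A B C \<delta>"
    and u: "dist u (triangle_sides d x y z) \<le> m"
    and v: "dist v (vertex_dists d x y z p) \<le> m"
    and m: "5 * m \<le> d x y" "5 * m \<le> d y z" "0 \<le> m"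
  shows "p \<in> points_with_far_partner X d m"
proof -
  have X: "x \<in> X" "y \<in> X" "z \<in> X" and pos: "d x y > 0" "d y z > 0"
    using assms(2) unfolding timelike_triangle_def by auto
  have "d x y + d y z \<le> d x z"
    using assms(1) X pos unfolding bounded_lm_space_def by blast
  then have c: "5 * m \<le> d x z"
    using m by linarith
  obtain a b c where uabc: "u = (a, b, c)" by (cases u)
  obtain xp py yp pz where veq: "v = (xp, py, yp, pz)" by (cases v)
  have comp: "dist (fst s) (fst t) \<le> m \<and> dist (snd s) (snd t) \<le> m" if "dist s t \<le> m"
    for s t :: "'c::metric_space \<times> 'd::metric_space"
    using that dist_fst_le[of s t] dist_snd_le[of s t] by linarith
  have "\<bar>a - d x y\<bar> \<le> m" "dist (b, c) (d y z, d x z) \<le> m"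
    using comp[OF u] by (auto simp: uabc triangle_sides_def dist_real_def)
  moreover from comp[OF this(2)] have "\<bar>b - d y z\<bar> \<le> m" "\<bar>c - d x z\<bar> \<le> m"
    by (auto simp: dist_real_def)
  ultimately have "2 * (2 * m) \<le> a" "2 * (2 * m) \<le> b" "2 * (2 * m) \<le> c"
    using m c by linarith+
  then have "2 * m \<le> xp \<or> 2 * m \<le> py \<or> 2 * m \<le> yp \<or> 2 * m \<le> pz"
    using corresponding_profiles_large_dist[OF uv[unfolded uabc veq]] by blast
  moreover have 1: "\<bar>xp - d x p\<bar> \<le> m" "dist (py, yp, pz) (d p y, d y p, d p z) \<le> m"
    using comp[OF v] by (auto simp: veq vertex_dists_def dist_real_def)
  moreover from comp[OF this(2)] have 2: "\<bar>py - d p y\<bar> \<le> m" "dist (yp, pz) (d y p, d p z) \<le> m"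
    by (auto simp: dist_real_def)
  moreover from comp[OF this(2)] have "\<bar>yp - d y p\<bar> \<le> m" "\<bar>pz - d p z\<bar> \<le> m"
    by (auto simp: dist_real_def)
  ultimately have "m \<le> d x p \<or> m \<le> d p y \<or> m \<le> d y p \<or> m \<le> d p z"
    by linarith
  then show ?thesis
    unfolding points_with_far_partner_def using X \<open>p \<in> X\<close> by blast
qed

lemma continuous_map_Pair_euclidean:
  fixes f :: "'a \<Rightarrow> 'b::topological_space" and g :: "'a \<Rightarrow> 'c::topological_space"
  assumes "continuous_map T euclidean f" "continuous_map T euclidean g"
  shows "continuous_map T euclidean (\<lambda>x. (f x, g x))"
  using assms continuous_map_pairedI[of T euclidean f euclidean g]
  by (simp add: euclidean_product_topology)

text \<open>Limits of approximate comparison pairs are found in this image: being a subset of a Euclidean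
  space it is sequentially compact, and its points are the data of actual pairs in \<open>K \<times> K\<close>.\<close>

lemma compact_pair_profiles:
  assumes T: "lm_admissible X d T" and K: "compactin T K" and X: "x \<in> X" "y \<in> X" "z \<in> X"
  shows "compact ((\<lambda>(p, q). (vertex_dists d x y z p, vertex_dists d x y z q, d p q)) ` (K \<times> K))"
proof -
  let ?P = "prod_topology T T"
  have d: "continuous_map ?P euclideanreal (\<lambda>(p, q). d p q)" and top: "topspace T = X"
    using T unfolding lm_admissible_def by auto
  have comp: "continuous_map ?P euclideanreal (\<lambda>w. d (f w) (g w))"
    if "continuous_map ?P T f" "continuous_map ?P T g" for f g
    using continuous_map_compose[OF continuous_map_pairedI[OF that] d] by (simp add: o_def)
  have const: "continuous_map ?P T (\<lambda>_. a)" if "a \<in> X" for a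
    using that top by simp
  have "continuous_map ?P euclidean
    (\<lambda>w. (vertex_dists d x y z (fst w), vertex_dists d x y z (snd w), d (fst w) (snd w)))"
    unfolding vertex_dists_def
    by (intro continuous_map_Pair_euclidean comp const X continuous_map_fst continuous_map_snd)
  moreover have "compactin ?P (K \<times> K)"
    using K by (simp add: compactin_Times)
  ultimately have "compactin euclidean ((\<lambda>w. (vertex_dists d x y z (fst w),
      vertex_dists d x y z (snd w), d (fst w) (snd w))) ` (K \<times> K))"
    by (rule image_compactin[rotated])
  then show ?thesis
    by (simp add: case_prod_beta)
qed

section \<open>Closed graph of an upper semi-continuous map\<close>

text \<open>If the limit \<open>m\<close> were outside the closed set \<open>F l\<close>, a closed ball around \<open>m\<close> would miss \<open>F l\<close>.
  Its complement is an open neighbourhood of \<open>F l\<close>, so it contains \<open>F (u k)\<close> for large \<open>k\<close>, which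
  keeps \<open>w k\<close> away from \<open>m\<close>.\<close>

lemma upper_semicontinuous_map_limit:
  fixes F :: "'a::metric_space \<Rightarrow> 'b::metric_space set"
  assumes closed: "closedin (top_of_set E) (F l)"
    and usc: "upper_semicontinuous_map (top_of_set \<Omega>) (top_of_set E) F"
    and u: "u \<longlonglongrightarrow> l" "l \<in> \<Omega>" "\<And>k. u k \<in> \<Omega>"
    and w: "w \<longlonglongrightarrow> m" "m \<in> E" "\<And>k. w k \<in> F (u k)"
  shows "m \<in> F l"
proof (rule ccontr)
  assume "m \<notin> F l"
  obtain S where S: "closed S" "F l = E \<inter> S"
    using closed by (auto simp: closedin_closed)
  with \<open>m \<notin> F l\<close> w(2) have "m \<in> - S" "open (- S)"
    by auto
  then obtain r where r: "r > 0" "cball m r \<subseteq> - S"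
    using open_contains_cball by blast
  have "openin (top_of_set E) (E \<inter> - cball m r)"
    by (intro openin_open_Int open_Compl closed_cball)
  moreover have "F l \<subseteq> E \<inter> - cball m r"
    using S(2) r(2) by blast
  ultimately obtain N where N: "openin (top_of_set \<Omega>) N" "l \<in> N"
    and FN: "(\<Union>v\<in>N. F v) \<subseteq> E \<inter> - cball m r"
    using usc u(2) unfolding upper_semicontinuous_map_def by (metis topspace_euclidean_subtopology)
  obtain G where G: "open G" "N = \<Omega> \<inter> G"
    using N(1) by (auto simp: openin_open)
  have "\<forall>\<^sub>F k in sequentially. u k \<in> G"
    using u(1) G N(2) by (auto intro: topological_tendstoD)
  moreover have "\<forall>\<^sub>F k in sequentially. dist (w k) m < r"
    using w(1) r(1) by (rule tendstoD)
  ultimately have "\<forall>\<^sub>F k in sequentially. False"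
  proof eventually_elim
    case (elim k)
    then have "w k \<in> - cball m r"
      using FN u(3)[of k] w(3)[of k] G(2) by blast
    with elim show ?case
      by (simp add: dist_commute)
  qed
  then show False
    by simp
qed

section \<open>Stability of sectional curvature bounds\<close>

lemma tendsto_of_dist_bound:
  fixes f g :: "nat \<Rightarrow> 'a::metric_space"
  assumes "g \<longlonglongrightarrow> l" "\<And>k. dist (f k) (g k) \<le> h k" "h \<longlonglongrightarrow> 0"
  shows "f \<longlonglongrightarrow> l"
proof (rule metric_tendsto_imp_tendsto)
  show "(\<lambda>k. h k + dist (g k) l) \<longlonglongrightarrow> 0"
    using tendsto_add[OF assms(3) tendsto_dist[OF assms(1) tendsto_const[of l]]] by simp
  show "\<forall>\<^sub>F k in sequentially. dist (f k) l \<le> dist (h k + dist (g k) l) 0"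
  proof (intro always_eventually allI)
    fix k
    have "dist (f k) l \<le> h k + dist (g k) l"
      using dist_triangle[of "f k" l "g k"] assms(2)[of k] by linarith
    then show "dist (f k) l \<le> dist (h k + dist (g k) l) 0"
      by (simp add: dist_real_def)
  qed
qed

theorem theorem6p7:
  fixes A B C :: "real^2"
    and \<Delta> :: "(real^2) set"
    and \<Omega> :: "(real \<times> real \<times> real) set"
    and F :: "real \<times> real \<times> real \<Rightarrow> ((real^2) \<times> (real^2) \<times> real) set"
    and Xn :: "nat \<Rightarrow> 'b set" and dn :: "nat \<Rightarrow> 'b \<Rightarrow> 'b \<Rightarrow> real"
    and X :: "'a set" and d :: "'a \<Rightarrow> 'a \<Rightarrow> real"
  assumes "\<not> collinear {A, B, C}"
    and "\<Delta> = reference_triangle A B C"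
    and "open \<Omega>"
    and "\<And>u. u \<in> \<Omega> \<Longrightarrow> closedin (top_of_set (\<Delta> \<times> \<Delta> \<times> UNIV)) (F u)"
    and "upper_semicontinuous_map (top_of_set \<Omega>) (top_of_set (\<Delta> \<times> \<Delta> \<times> UNIV)) F"
    and "\<And>n. bounded_lorentzian_length_space (Xn n) (dn n)"
    and "bounded_lorentzian_length_space X d"
    and "(\<lambda>n. gh_dist (Xn n) (dn n) X d) \<longlonglongrightarrow> 0"
    and "\<And>n. bounded_sectional_curvature A B C \<Omega> F (Xn n) (dn n)"
  shows "bounded_sectional_curvature A B C \<Omega> F X d"
  unfolding bounded_sectional_curvature_def
proof (intro allI impI ballI, elim conjE)
  fix x y z \<delta>\<^sub>1 \<delta>\<^sub>2
  assume tri: "timelike_triangle X d x y z" and in\<Omega>: "(d x y, d y z, d x z) \<in> \<Omega>"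
    and \<delta>: "\<delta>\<^sub>1 \<in> reference_triangle A B C" "\<delta>\<^sub>2 \<in> reference_triangle A B C"
  let ?u = "triangle_sides d x y z" and ?v = "vertex_dists d x y z"
  have spaces: "bounded_lm_space X d" "\<And>n. bounded_lm_space (Xn n) (dn n)"
    using assms(6,7) unfolding bounded_lorentzian_length_space_def by auto
  have X: "x \<in> X" "y \<in> X" "z \<in> X" and pos: "d x y > 0" "d y z > 0"
    using tri unfolding timelike_triangle_def by auto
  have "d x y + d y z \<le> d x z"
    using spaces(1) X pos unfolding bounded_lm_space_def by blast
  with pos have "d x z > 0"
    by linarith
  note pos = pos this
  have "?u \<in> \<Omega>"
    using in\<Omega> by (simp add: triangle_sides_def)
  then obtain r where r: "r > 0" "cball ?u r \<subseteq> \<Omega>"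
    using assms(3) open_contains_cball by blast
  \<comment> \<open>All errors will be at most \<open>m\<close>: small enough to stay in \<open>\<Omega>\<close> and to keep the comparison points
    in the compact set \<open>K\<close>.\<close>
  define m where "m = Min {r, d x y / 5, d y z / 5}"
  have m: "m > 0" "m \<le> r" "5 * m \<le> d x y" "5 * m \<le> d y z"
    using r(1) pos unfolding m_def by (auto simp: min_def)
  define K where "K = points_with_far_partner X d m"
  obtain T where T: "lm_admissible X d T"
    using spaces(1) unfolding bounded_lm_space_def by blast
  \<comment> \<open>The bound \<open>h k\<close> on the distortion gives errors up to \<open>4 * h k\<close> in the distances to the vertices,
    whence the factor \<open>4\<close>.\<close>
  define h where "h k = m / 4 / real (Suc k)" for k
  have h: "h k > 0" "4 * h k \<le> m" for k
  proof -
    show "h k > 0"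
      using m(1) by (simp add: h_def)
    have "m / real (Suc k) \<le> m / 1"
      using m(1) by (intro divide_left_mono) auto
    moreover have "4 * h k = m / real (Suc k)"
      unfolding h_def by (simp only: divide_divide_eq_left times_divide_eq_right
          mult_divide_mult_cancel_left_if) simp
    ultimately show "4 * h k \<le> m"
      by simp
  qed
  have "h \<longlonglongrightarrow> 0"
    unfolding h_def by (rule LIMSEQ_Suc[OF lim_const_over_n])
  have "\<exists>p q u v w s. p \<in> K \<and> q \<in> K \<and> u \<in> \<Omega> \<and> dist u ?u \<le> 3 * h k \<and>
      (u, v) \<in> corresponding_profiles A B C \<delta>\<^sub>1 \<and> dist v (?v p) \<le> 4 * h k \<and>
      (u, w) \<in> corresponding_profiles A B C \<delta>\<^sub>2 \<and> dist w (?v q) \<le> 4 * h k \<and>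
      (\<delta>\<^sub>1, \<delta>\<^sub>2, s) \<in> F u \<and> dist s (d p q) \<le> h k" for k
  proof -
    have "\<forall>\<^sub>F n in sequentially. gh_dist (Xn n) (dn n) X d < ennreal (h k)"
      using assms(8) h(1) by (intro order_tendstoD) auto
    then obtain n where n: "gh_dist (Xn n) (dn n) X d < ennreal (h k)"
      using eventually_happens trivial_limit_sequentially by blast
    have near: "u \<in> \<Omega>" if "dist u ?u \<le> 3 * h k" for u
    proof -
      have "u \<in> cball ?u r"
        using that h[of k] m(2) by (simp add: dist_commute)
      then show ?thesis
        using r(2) by blast
    qed
    have small: "h k < d x y" "h k < d y z"
      using h[of k] m by linarith+
    obtain p q u v w s where o: "p \<in> X" "q \<in> X" "u \<in> \<Omega>" "dist u ?u \<le> 3 * h k"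
      "(u, v) \<in> corresponding_profiles A B C \<delta>\<^sub>1" "dist v (?v p) \<le> 4 * h k"
      "(u, w) \<in> corresponding_profiles A B C \<delta>\<^sub>2" "dist w (?v q) \<le> 4 * h k"
      "(\<delta>\<^sub>1, \<delta>\<^sub>2, s) \<in> F u" "dist s (d p q) \<le> h k"
      by (rule approximate_comparison_pair
          [OF spaces(1) spaces(2) n assms(9) \<delta> tri near small])
    have "dist u ?u \<le> m" "dist v (?v p) \<le> m" "dist w (?v q) \<le> m"
      using o(4,6,8) h[of k] by linarith+
    then have "p \<in> K" "q \<in> K"
      unfolding K_def
      using nearby_profile_has_far_partner[OF spaces(1) tri o(1) o(5)]
        nearby_profile_has_far_partner[OF spaces(1) tri o(2) o(7)] m by auto
    with o show ?thesis
      by blast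
  qed
  then obtain p q u v w s where
    K: "\<And>k. p k \<in> K" "\<And>k. q k \<in> K" and
    u: "\<And>k. u k \<in> \<Omega>" "\<And>k. dist (u k) ?u \<le> 3 * h k" and
    v: "\<And>k. (u k, v k) \<in> corresponding_profiles A B C \<delta>\<^sub>1"
       "\<And>k. dist (v k) (?v (p k)) \<le> 4 * h k" and
    w: "\<And>k. (u k, w k) \<in> corresponding_profiles A B C \<delta>\<^sub>2"
       "\<And>k. dist (w k) (?v (q k)) \<le> 4 * h k" and
    s: "\<And>k. (\<delta>\<^sub>1, \<delta>\<^sub>2, s k) \<in> F (u k)" "\<And>k. dist (s k) (d (p k) (q k)) \<le> h k"
    by metis
  let ?\<Phi> = "\<lambda>(p, q). (?v p, ?v q, d p q)"
  have "compact (?\<Phi> ` (K \<times> K))"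
    unfolding K_def
    by (intro compact_pair_profiles[OF T] compactin_points_with_far_partner[OF T m(1)] X)
  moreover have "\<forall>k. ?\<Phi> (p k, q k) \<in> ?\<Phi> ` (K \<times> K)"
    using K by blast
  ultimately obtain l \<phi> where l: "l \<in> ?\<Phi> ` (K \<times> K)" and \<phi>: "strict_mono (\<phi> :: nat \<Rightarrow> nat)"
    and lim: "((\<lambda>k. ?\<Phi> (p k, q k)) \<circ> \<phi>) \<longlonglongrightarrow> l"
    unfolding compact_def by meson
  obtain p\<^sub>0 q\<^sub>0 where pq: "p\<^sub>0 \<in> K" "q\<^sub>0 \<in> K" and leq: "l = (?v p\<^sub>0, ?v q\<^sub>0, d p\<^sub>0 q\<^sub>0)"
    using l by auto
  have lims: "(\<lambda>k. ?v (p (\<phi> k))) \<longlonglongrightarrow> ?v p\<^sub>0" "(\<lambda>k. ?v (q (\<phi> k))) \<longlonglongrightarrow> ?v q\<^sub>0"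
    "(\<lambda>k. d (p (\<phi> k)) (q (\<phi> k))) \<longlonglongrightarrow> d p\<^sub>0 q\<^sub>0"
    using tendsto_fst[OF lim] tendsto_fst[OF tendsto_snd[OF lim]]
      tendsto_snd[OF tendsto_snd[OF lim]] by (simp_all add: leq o_def)
  have h\<phi>: "(\<lambda>k. c * h (\<phi> k)) \<longlonglongrightarrow> 0" for c
    using tendsto_mult_right_zero[OF LIMSEQ_subseq_LIMSEQ[OF \<open>h \<longlonglongrightarrow> 0\<close> \<phi>]] by (simp add: o_def)
  have ulim: "(\<lambda>k. u (\<phi> k)) \<longlonglongrightarrow> ?u"
    using tendsto_of_dist_bound[OF tendsto_const u(2) h\<phi>] .
  have vlim: "(\<lambda>k. v (\<phi> k)) \<longlonglongrightarrow> ?v p\<^sub>0"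
    using tendsto_of_dist_bound[OF lims(1) v(2) h\<phi>] .
  have wlim: "(\<lambda>k. w (\<phi> k)) \<longlonglongrightarrow> ?v q\<^sub>0"
    using tendsto_of_dist_bound[OF lims(2) w(2) h\<phi>] .
  have slim: "(\<lambda>k. s (\<phi> k)) \<longlonglongrightarrow> d p\<^sub>0 q\<^sub>0"
    using tendsto_of_dist_bound[OF lims(3) s(2)] h\<phi>[of 1] by simp
  have "(?u, ?v p\<^sub>0) \<in> corresponding_profiles A B C \<delta>\<^sub>1"
    using corresponding_profiles_limit[OF v(1)] ulim vlim pos
    unfolding triangle_sides_def vertex_dists_def by blast
  moreover have "(?u, ?v q\<^sub>0) \<in> corresponding_profiles A B C \<delta>\<^sub>2"
    using corresponding_profiles_limit[OF w(1)] ulim wlim pos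
    unfolding triangle_sides_def vertex_dists_def by blast
  moreover have "p\<^sub>0 \<in> X" "q\<^sub>0 \<in> X"
    using pq unfolding K_def points_with_far_partner_def by auto
  ultimately have corr: "corresponds A B C X d x y z p\<^sub>0 \<delta>\<^sub>1" "corresponds A B C X d x y z q\<^sub>0 \<delta>\<^sub>2"
    using corresponds_iff_profile[of d, OF pos] by blast+
  have "(\<delta>\<^sub>1, \<delta>\<^sub>2, d p\<^sub>0 q\<^sub>0) \<in> F ?u"
  proof (rule upper_semicontinuous_map_limit[OF assms(4) assms(5) ulim])
    show "(\<lambda>k. (\<delta>\<^sub>1, \<delta>\<^sub>2, s (\<phi> k))) \<longlonglongrightarrow> (\<delta>\<^sub>1, \<delta>\<^sub>2, d p\<^sub>0 q\<^sub>0)"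
      by (intro tendsto_intros slim)
  qed (use \<delta> assms(2) u(1) s(1) \<open>?u \<in> \<Omega>\<close> in auto)
  then show "\<exists>p\<in>perimeter X d x y z. \<exists>q\<in>perimeter X d x y z.
      corresponds A B C X d x y z p \<delta>\<^sub>1 \<and> corresponds A B C X d x y z q \<delta>\<^sub>2 \<and>
      (\<delta>\<^sub>1, \<delta>\<^sub>2, d p q) \<in> F (d x y, d y z, d x z)"
    using corr by (intro bexI[of _ p\<^sub>0] bexI[of _ q\<^sub>0] conjI corresponds_imp_perimeter)
      (simp_all add: triangle_sides_def)
qed

end
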